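(* Assume that the common influencer condition (CI) stated in the context holds. Then every solution $\{x_i(t)\}_{i=1}^N$ of the delayed system $$\frac{d}{dt}x_i(t)=\frac{1}{N-1}\sum_{j\neq i}\chi_{ij}\,a_{ij}(t)\,\big(x_j(t-\tau_{ij})-x_i(t)\big),\quad t>0,\ i=1,\dots,N,$$ with initial conditions $x_i(t)=x_i^0(t)$, $t\in[-\tau,0]$, $i=1,\dots,N$, satisfies the exponential decay estimate $$d(t)\le D_0\,e^{-\gamma(t-2\tau)}\quad\text{for all } t\ge 0,$$ for a suitable positive constant $\gamma$.
   Context: Let $N\ge 3$ be an integer, let $\mathbb{R}^d$ carry the Euclidean norm $|\cdot|$, and let $x_i(t)\in\mathbb{R}^d$ be the opinion of agent $i$ at time $t$. The delays $\tau_{ij}$, $i,j=1,\dots,N$, are positive constants and $\tau:=\max_{i,j=1,\dots,N}\tau_{ij}$. The weights are $a_{ij}(t):=\psi_{ij}(x_i(t),x_j(t-\tau_{ij}))$, where the influence functions $\psi_{ij}:\mathbb{R}^d\times\mathbb{R}^d\to\mathbb{R}$ are positive, bounded and continuous. The coefficients are $\chi_{ij}=1$ if agent $j$ transmits information to agent $i$ and $\chi_{ij}=0$ otherwise. The initial data $x_i^0:[-\tau,0]\to\mathbb{R}^d$ are continuous. A solution is a family of continuous functions $x_i:[-\tau,\infty)\to\mathbb{R}^d$ equal to $x_i^0$ on $[-\tau,0]$ and satisfying the system for $t>0$. Condition (CI): for all $i,j\in\{1,\dots,N\}$ there exists $k\in\{1,\dots,N\}$, with $k\ne i$ and $k\neq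 j$, such that $\chi_{ik}=\chi_{jk}=1$ and $\tau_{ik}=\tau_{jk}$. Notation: $d(t):=\max_{i,j=1,\dots,N}|x_i(t)-x_j(t)|$ and $D_0:=\max_{i,j=1,\dots,N}\max_{s,t\in[-\tau,0]}|x_i(s)-x_j(t)|$. *)

theory Defs
  imports "HOL-Analysis.Analysis"
begin

text \<open>Agents are indexed by \<open>{1..N}\<close>; values of the data at indices outside this
  range play no role.\<close>

definition max_delay :: "nat \<Rightarrow> (nat \<Rightarrow> nat \<Rightarrow> real) \<Rightarrow> real" where
  "max_delay N \<tau> = Max {\<tau> i j | i j. i \<in> {1..N} \<and> j \<in> {1..N}}"

definition weight ::
  "(nat \<Rightarrow> nat \<Rightarrow> (real^'d) \<times> (real^'d) \<Rightarrow> real) \<Rightarrow> (nat \<Rightarrow> nat \<Rightarrow> real)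
    \<Rightarrow> (nat \<Rightarrow> real \<Rightarrow> real^'d) \<Rightarrow> nat \<Rightarrow> nat \<Rightarrow> real \<Rightarrow> real" where
  "weight \<psi> \<tau> x i j t = \<psi> i j (x i t, x j (t - \<tau> i j))"

definition common_influencer ::
  "nat \<Rightarrow> (nat \<Rightarrow> nat \<Rightarrow> real) \<Rightarrow> (nat \<Rightarrow> nat \<Rightarrow> real) \<Rightarrow> bool" where
  "common_influencer N chi \<tau> \<longleftrightarrow>
    (\<forall>i\<in>{1..N}. \<forall>j\<in>{1..N}. \<exists>k\<in>{1..N}.
      k \<noteq> i \<and> k \<noteq> j \<and> chi i k = 1 \<and> chi j k = 1 \<and> \<tau> i k = \<tau> j k)"

text \<open>Each trajectory is a total function on the reals, of which only the restriction to
  \<open>{- max_delay N \<tau>..}\<close> matters. The derivative is two-sided and required for \<open>t > 0\<close> only.\<close>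

definition is_solution ::
  "nat \<Rightarrow> (nat \<Rightarrow> nat \<Rightarrow> real) \<Rightarrow> (nat \<Rightarrow> nat \<Rightarrow> real)
    \<Rightarrow> (nat \<Rightarrow> nat \<Rightarrow> (real^'d) \<times> (real^'d) \<Rightarrow> real)
    \<Rightarrow> (nat \<Rightarrow> real \<Rightarrow> real^'d) \<Rightarrow> (nat \<Rightarrow> real \<Rightarrow> real^'d) \<Rightarrow> bool" where
  "is_solution N chi \<tau> \<psi> x0 x \<longleftrightarrow>
    (\<forall>i\<in>{1..N}.
      continuous_on {- max_delay N \<tau>..} (x i) \<and>
      (\<forall>t\<in>{- max_delay N \<tau>..0}. x i t = x0 i t) \<and>
      (\<forall>t>0. (x i has_vector_derivative
          (1 / (real N - 1)) *\<^sub>R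
            (\<Sum>j\<in>{1..N} - {i}. (chi i j * weight \<psi> \<tau> x i j t) *\<^sub>R (x j (t - \<tau> i j) - x i t)))
        (at t)))"

definition opinion_diameter :: "nat \<Rightarrow> (nat \<Rightarrow> real \<Rightarrow> real^'d) \<Rightarrow> real \<Rightarrow> real" where
  "opinion_diameter N x t = Max {norm (x i t - x j t) | i j. i \<in> {1..N} \<and> j \<in> {1..N}}"

text \<open>The maximum over times is written as a supremum; it is attained for trajectories that
  are continuous on the compact interval \<open>{- max_delay N \<tau>..0}\<close>.\<close>

definition initial_diameter ::
  "nat \<Rightarrow> (nat \<Rightarrow> nat \<Rightarrow> real) \<Rightarrow> (nat \<Rightarrow> real \<Rightarrow> real^'d) \<Rightarrow> real" where
  "initial_diameter N \<tau> x =
    Max {(SUP (s, t) \<in> {- max_delay N \<tau>..0} \<times> {- max_delay N \<tau>..0}. norm (x i s - x j t))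
         | i j. i \<in> {1..N} \<and> j \<in> {1..N}}"

end

theory Submission
  imports Defs
begin

text \<open>Project the trajectories to a direction \<open>v\<close>. Values lying in \<open>[m, M]\<close> on a time window of
  the length of the maximal delay stay there. Two agents \<open>i\<close>, \<open>j\<close> are pulled at every time towards
  the same value of their common influencer, because the two delays agree. In the sum of the gaps
  \<open>x i t \<bullet> v - m\<close> and \<open>M - x j t \<bullet> v\<close> the unknown value of the influencer cancels, so the sum
  grows to a fixed fraction of \<open>M - m\<close>. A gap decays at most exponentially, which extends this
  to different times within one window. Hence the diameter over a window shrinks by a fixed factor
  after two maximal delays.\<close>

section \<open>Scalar differential inequalities and projections\<close>

lemma nonpos_if_nonincreasing_where_pos:
  fixes g :: "real \<Rightarrow> real"
  assumes "a \<le> b" and cont: "continuous_on {a..b} g" and ga: "g a \<le> 0"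
    and der: "\<And>t. a < t \<Longrightarrow> t < b \<Longrightarrow> 0 < g t \<Longrightarrow> \<exists>d\<le>0. (g has_real_derivative d) (at t)"
  shows "g b \<le> 0"
proof (rule ccontr)
  assume "\<not> g b \<le> 0"
  define S where "S = {t \<in> {a..b}. g t \<le> 0}"
  have "closed S"
    unfolding S_def using continuous_closed_preimage[OF cont, of "{..0}"]
    by (simp add: vimage_def Int_def)
  have "a \<in> S" and bdd: "bdd_above S"
    using \<open>a \<le> b\<close> ga by (auto simp: S_def intro!: bdd_aboveI[of _ b])
  \<comment> \<open>\<open>c\<close> is the last time at which \<open>g\<close> is nonpositive.
    Beyond it \<open>g\<close> stays positive, so the derivative hypothesis applies on the whole
    open interval from \<open>c\<close> to \<open>b\<close>.\<close>
  define c where "c = Sup S"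
  have "c \<in> S"
    unfolding c_def using \<open>closed S\<close> \<open>a \<in> S\<close> bdd by (intro closed_contains_Sup) auto
  then have c: "a \<le> c" "c \<le> b" "g c \<le> 0"
    by (auto simp: S_def)
  have pos: "0 < g t" if "c < t" "t \<le> b" for t
  proof (rule ccontr)
    assume "\<not> 0 < g t"
    with that c have "t \<in> S" by (auto simp: S_def)
    then have "t \<le> c" unfolding c_def using bdd by (rule cSup_upper)
    with that show False by simp
  qed
  have "g b \<le> g c"
  proof (rule DERIV_nonpos_imp_decreasing_open[where f = g])
    show "continuous_on {c..b} g"
      using cont by (rule continuous_on_subset) (use c in auto)
    show "\<exists>y. (g has_real_derivative y) (at t) \<and> y \<le> 0" if "c < t" "t < b" for t
      using der[of t] pos[of t] that c by auto
  qed (use c in auto)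
  with c \<open>\<not> g b \<le> 0\<close> show False by simp
qed

text \<open>Variation of constants: the integrating factor \<open>exp (K * t)\<close> makes
  \<open>u - c / K\<close> nondecreasing. The left-hand side is the value at \<open>b\<close> of the
  solution of y' = c - K y that starts at \<open>u a\<close>.\<close>

lemma linear_differential_inequality:
  fixes u u' :: "real \<Rightarrow> real"
  assumes "a \<le> b" and K: "K > 0" and cont: "continuous_on {a..b} u"
    and der: "\<And>t. a < t \<Longrightarrow> t < b \<Longrightarrow> (u has_real_derivative u' t) (at t)"
    and ge: "\<And>t. a < t \<Longrightarrow> t < b \<Longrightarrow> c - K * u t \<le> u' t"
  shows "exp (- K * (b - a)) * u a + c / K * (1 - exp (- K * (b - a))) \<le> u b"
proof -
  define w where "w t = exp (K * t) * (u t - c / K)" for t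
  have "w a \<le> w b"
  proof (rule DERIV_nonneg_imp_increasing_open[where f = w])
    show "continuous_on {a..b} w"
      unfolding w_def by (intro continuous_intros cont)
    show "\<exists>y. (w has_real_derivative y) (at t) \<and> 0 \<le> y" if t: "a < t" "t < b" for t
    proof (intro exI conjI)
      show "(w has_real_derivative exp (K * t) * (K * u t - c + u' t)) (at t)"
        unfolding w_def using K
        by (auto intro!: derivative_eq_intros der[OF t] simp: algebra_simps)
      show "0 \<le> exp (K * t) * (K * u t - c + u' t)"
        using ge[OF t] by simp
    qed
  qed fact
  then have "exp (- K * b) * w a \<le> exp (- K * b) * w b"
    by simp
  moreover have "exp (- K * b) * w b = u b - c / K"
    by (simp add: w_def exp_minus)
  moreover have "exp (- K * b) * w a = exp (- K * (b - a)) * (u a - c / K)"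
  proof -
    have "exp (- K * (b - a)) = exp (- K * b) * exp (K * a)"
      by (simp add: exp_add[symmetric] algebra_simps)
    then show ?thesis by (simp add: w_def)
  qed
  ultimately have "exp (- K * (b - a)) * (u a - c / K) \<le> u b - c / K"
    by linarith
  then show ?thesis
    by (simp add: algebra_simps)
qed

text \<open>For nonempty \<open>S\<close> the choice \<open>m = Inf S\<close> works, because
  \<open>y - D\<close> is a lower bound of \<open>S\<close> for each \<open>y\<close> in
  \<open>S\<close>. This turns a bound on pairwise differences into an interval for the projected
  values.\<close>

lemma subset_atLeastAtMost_of_diff_le:
  fixes S :: "real set"
  assumes "\<And>y z. y \<in> S \<Longrightarrow> z \<in> S \<Longrightarrow> y - z \<le> D"
  shows "\<exists>m. S \<subseteq> {m..m + D}"
proof (cases "S = {}")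
  case False
  then obtain y0 where y0: "y0 \<in> S" by auto
  have bdd: "bdd_below S"
    using assms[OF y0] by (intro bdd_belowI[of _ "y0 - D"]) (auto simp: algebra_simps)
  have "y \<le> Inf S + D" if "y \<in> S" for y
  proof -
    have "y - D \<le> Inf S"
      using False assms[OF that] by (intro cInf_greatest) (auto simp: algebra_simps)
    then show ?thesis by simp
  qed
  then show ?thesis
    using cInf_lower[OF _ bdd] by (intro exI[of _ "Inf S"]) auto
qed auto

lemma inner_sgn_eq_norm: "z \<bullet> sgn z = norm z" for z :: "'a::real_inner"
  by (cases "z = 0") (simp_all add: sgn_div_norm dot_square_norm power2_eq_square)

section \<open>Delayed averaging with nonnegative weights: bounds that persist\<close>

locale delayed_averaging =
  fixes I :: "'i set" and \<tau> :: "'i \<Rightarrow> 'i \<Rightarrow> real" and r :: real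
    and A :: "'i \<Rightarrow> 'i \<Rightarrow> real \<Rightarrow> real" and x :: "'i \<Rightarrow> real \<Rightarrow> 'a::real_inner"
  assumes finite_I: "finite I"
    and delay_pos: "\<And>i j. i \<in> I \<Longrightarrow> j \<in> I \<Longrightarrow> 0 < \<tau> i j"
    and delay_le: "\<And>i j. i \<in> I \<Longrightarrow> j \<in> I \<Longrightarrow> \<tau> i j \<le> r"
    and continuous: "\<And>i. i \<in> I \<Longrightarrow> continuous_on {- r..} (x i)"
    and A_nonneg: "\<And>i j t. i \<in> I \<Longrightarrow> j \<in> I \<Longrightarrow> 0 < t \<Longrightarrow> 0 \<le> A i j t"
    and derivative: "\<And>i t. i \<in> I \<Longrightarrow> 0 < t \<Longrightarrow>
      (x i has_vector_derivative (\<Sum>j\<in>I - {i}. A i j t *\<^sub>R (x j (t - \<tau> i j) - x i t))) (at t)"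
begin

text \<open>The weights \<open>A\<close> are functions of time alone: their dependence on the
  opinions is frozen along the given solution. Hence each projection obeys a scalar linear delay
  equation, with this right-hand side.\<close>

definition rate :: "'a \<Rightarrow> 'i \<Rightarrow> real \<Rightarrow> real" where
  "rate v i t = (\<Sum>j\<in>I - {i}. A i j t * (x j (t - \<tau> i j) \<bullet> v - x i t \<bullet> v))"

text \<open>A window of length \<open>r\<close> covers every delayed value that enters after time
  \<open>T\<close>. Different times are compared as well, so that all projected values of the window
  fit into one interval of length \<open>D\<close>.\<close>

definition confined :: "real \<Rightarrow> real \<Rightarrow> bool" where
  "confined T D \<longleftrightarrow>
    (\<forall>i\<in>I. \<forall>j\<in>I. \<forall>s\<in>{T - r..T}. \<forall>t\<in>{T - r..T}. norm (x i s - x j t) \<le> D)"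

lemma has_derivative_inner:
  assumes "i \<in> I" "0 < t"
  shows "((\<lambda>t. x i t \<bullet> v) has_real_derivative rate v i t) (at t)"
proof -
  have "((\<lambda>t. x i t \<bullet> v) has_vector_derivative
      (\<Sum>j\<in>I - {i}. A i j t *\<^sub>R (x j (t - \<tau> i j) - x i t)) \<bullet> v) (at t)"
    by (rule bounded_linear.has_vector_derivative[OF bounded_linear_inner_left])
      (rule derivative[OF assms])
  then show ?thesis
    by (simp add: has_real_derivative_iff_has_vector_derivative rate_def inner_sum_left
        inner_diff_left)
qed

lemma continuous_on_inner_trajectory:
  assumes "i \<in> I" "S \<subseteq> {- r..}"
  shows "continuous_on S (\<lambda>t. x i t \<bullet> v)"
  by (intro continuous_intros continuous_on_subset[OF continuous] assms)

lemma rate_minus: "rate (- v) i t = - rate v i t"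
  by (simp add: rate_def sum_negf[symmetric] algebra_simps)

text \<open>Method of steps with a step \<open>h\<close> below all delays: on the next interval of
  length \<open>h\<close> all delayed values are already known to be at most \<open>M\<close>.
  Wherever a projection exceeds \<open>M\<close>, its rate is therefore nonpositive.\<close>

lemma max_principle:
  assumes "0 \<le> T"
    and init: "\<And>i s. i \<in> I \<Longrightarrow> s \<in> {T - r..T} \<Longrightarrow> x i s \<bullet> v \<le> M"
    and "i \<in> I" "T - r \<le> s"
  shows "x i s \<bullet> v \<le> M"
proof -
  \<comment> \<open>The element \<open>1\<close> makes \<open>P\<close> nonempty without a look at
    \<open>I\<close>; any positive lower bound of the delays serves as step size.\<close>
  define P where "P = insert 1 ((\<lambda>(i, j). \<tau> i j) ` (I \<times> I))"
  define h where "h = Min P"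
  have P: "finite P" "P \<noteq> {}"
    using finite_I by (auto simp: P_def)
  have h: "0 < h"
    unfolding h_def using P delay_pos by (subst Min_gr_iff) (auto simp: P_def)
  have h_le: "h \<le> \<tau> i j" if "i \<in> I" "j \<in> I" for i j
    unfolding h_def using P that by (intro Min_le) (auto simp: P_def)
  have step: "\<forall>i\<in>I. \<forall>s. T - r \<le> s \<and> s \<le> T + real n * h \<longrightarrow> x i s \<bullet> v \<le> M" for n
  proof (induction n)
    case 0
    then show ?case using init by auto
  next
    case (Suc n)
    show ?case
    proof (intro ballI allI impI)
      fix i s
      assume i: "i \<in> I" and s: "T - r \<le> s \<and> s \<le> T + real (Suc n) * h"
      define a where "a = T + real n * h"
      have a: "T \<le> a" using h by (simp add: a_def)
      show "x i s \<bullet> v \<le> M"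
      proof (cases "s \<le> a")
        case True
        then show ?thesis using Suc i s by (auto simp: a_def)
      next
        case False
        have r: "0 < r" using delay_pos[OF i i] delay_le[OF i i] by simp
        have "x i s \<bullet> v - M \<le> 0"
        proof (rule nonpos_if_nonincreasing_where_pos[where g = "\<lambda>t. x i t \<bullet> v - M"])
          show "a \<le> s" using False by simp
          show "continuous_on {a..s} (\<lambda>t. x i t \<bullet> v - M)"
            using a \<open>0 \<le> T\<close> r i
            by (intro continuous_intros continuous_on_inner_trajectory) auto
          show "x i a \<bullet> v - M \<le> 0"
            using Suc i a r by (auto simp: a_def)
        next
          fix t
          assume t: "a < t" "t < s" and pos: "0 < x i t \<bullet> v - M"
          have "t > 0" using t a \<open>0 \<le> T\<close> by simp
          have le: "x j (t - \<tau> i j) \<bullet> v \<le> M" if j: "j \<in> I" for j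
          proof -
            have "t - \<tau> i j \<le> T + real n * h"
              using h_le[OF i j] t s by (simp add: algebra_simps)
            moreover have "T - r \<le> t - \<tau> i j"
              using delay_le[OF i j] t a by simp
            ultimately show ?thesis using Suc j by auto
          qed
          have "rate v i t \<le> 0"
            unfolding rate_def
          proof (rule sum_nonpos)
            fix j
            assume j: "j \<in> I - {i}"
            then have "0 \<le> A i j t" using A_nonneg i \<open>t > 0\<close> by auto
            then show "A i j t * (x j (t - \<tau> i j) \<bullet> v - x i t \<bullet> v) \<le> 0"
              using le[of j] pos j by (intro mult_nonneg_nonpos) auto
          qed
          moreover have "((\<lambda>t. x i t \<bullet> v - M) has_real_derivative rate v i t) (at t)"
            using has_derivative_inner[OF i \<open>t > 0\<close>, of v]
            by (auto intro!: derivative_eq_intros)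
          ultimately show "\<exists>d\<le>0. ((\<lambda>t. x i t \<bullet> v - M) has_real_derivative d) (at t)"
            by blast
        qed
        then show ?thesis by simp
      qed
    qed
  qed
  obtain n where "(s - T) / h \<le> real n"
    using real_arch_simple by blast
  then have "s \<le> T + real n * h"
    using h by (simp add: field_simps)
  with step[of n] assms show ?thesis by auto
qed

lemma min_principle:
  assumes "0 \<le> T"
    and "\<And>i s. i \<in> I \<Longrightarrow> s \<in> {T - r..T} \<Longrightarrow> m \<le> x i s \<bullet> v"
    and "i \<in> I" "T - r \<le> s"
  shows "m \<le> x i s \<bullet> v"
  using max_principle[of T "- v" "- m" i s] assms by simp

text \<open>Cauchy-Schwarz on the window, then the two extremum principles for all later times.
  Asking for \<open>norm v \<le> 1\<close> and not for equality admits \<open>v = sgn 0 = 0\<close>,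
  which occurs below when two opinions coincide.\<close>

lemma confined_bounds:
  assumes "confined T D" "0 \<le> T" "norm v \<le> 1"
  obtains m where "\<And>i s. i \<in> I \<Longrightarrow> T - r \<le> s \<Longrightarrow> m \<le> x i s \<bullet> v"
    and "\<And>i s. i \<in> I \<Longrightarrow> T - r \<le> s \<Longrightarrow> x i s \<bullet> v \<le> m + D"
proof -
  define S where "S = (\<lambda>(i, s). x i s \<bullet> v) ` (I \<times> {T - r..T})"
  have "y - z \<le> D" if yz: "y \<in> S" "z \<in> S" for y z
  proof -
    obtain i j s t where ij: "i \<in> I" "j \<in> I" "s \<in> {T - r..T}" "t \<in> {T - r..T}"
      and "y = x i s \<bullet> v" "z = x j t \<bullet> v"
      using yz by (force simp: S_def)
    then have "y - z = (x i s - x j t) \<bullet> v"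
      by (simp add: inner_diff_left)
    also have "\<dots> \<le> norm (x i s - x j t) * norm v"
      by (rule norm_cauchy_schwarz)
    also have "\<dots> \<le> norm (x i s - x j t) * 1"
      using \<open>norm v \<le> 1\<close> by (intro mult_left_mono) auto
    also have "\<dots> \<le> D"
      using assms(1) ij by (auto simp: confined_def)
    finally show ?thesis .
  qed
  then obtain m where m: "S \<subseteq> {m..m + D}"
    using subset_atLeastAtMost_of_diff_le by blast
  have "x i s \<bullet> v \<in> S" if "i \<in> I" "s \<in> {T - r..T}" for i s
    using that unfolding S_def by force
  with m have "m \<le> x i s \<bullet> v" "x i s \<bullet> v \<le> m + D" if "i \<in> I" "s \<in> {T - r..T}" for i s
    using that by (meson subsetD atLeastAtMost_iff)+
  with that show ?thesis
    using min_principle[OF \<open>0 \<le> T\<close>] max_principle[OF \<open>0 \<le> T\<close>] by metis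
qed

lemma confined_forever:
  assumes "confined T D" "0 \<le> T" "i \<in> I" "j \<in> I" "T - r \<le> s" "T - r \<le> t"
  shows "norm (x i s - x j t) \<le> D"
proof -
  \<comment> \<open>Projection to the direction of the difference itself recovers its norm.\<close>
  define v where "v = sgn (x i s - x j t)"
  have "norm v \<le> 1" by (simp add: v_def norm_sgn)
  obtain m where "m \<le> x j t \<bullet> v" "x i s \<bullet> v \<le> m + D"
    using confined_bounds[OF assms(1,2) \<open>norm v \<le> 1\<close>] assms(3-) by metis
  then have "(x i s - x j t) \<bullet> v \<le> D"
    by (simp add: inner_diff_left)
  then show ?thesis
    by (simp add: v_def inner_sgn_eq_norm)
qed

end

section \<open>Contraction through common influencers\<close>

locale delayed_averaging_common_influencer = delayed_averaging +
  fixes K c :: real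
  assumes K_pos: "0 < K" and c_pos: "0 < c" and r_pos: "0 < r"
    and A_sum_le: "\<And>i t. i \<in> I \<Longrightarrow> 0 < t \<Longrightarrow> (\<Sum>j\<in>I - {i}. A i j t) \<le> K"
    and influencer: "\<And>i j. i \<in> I \<Longrightarrow> j \<in> I \<Longrightarrow> \<exists>k\<in>I - {i, j}. \<tau> i k = \<tau> j k \<and>
      (\<forall>t>0. c \<le> A i k t \<and> c \<le> A j k t)"
begin

text \<open>Measured from the lower bound \<open>m\<close>, all incoming terms are nonnegative, so
  all but that of \<open>k\<close> may be dropped; the outgoing term has total weight at most
  \<open>K\<close>. It is used with \<open>b = c\<close> for the pull of an influencer and with
  \<open>b = 0\<close> for plain decay.\<close>

lemma rate_ge:
  assumes ge: "\<And>j s. j \<in> I \<Longrightarrow> T - r \<le> s \<Longrightarrow> m \<le> x j s \<bullet> v"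
    and "0 \<le> T" "T < t" "i \<in> I" "k \<in> I - {i}" and b: "b \<le> A i k t"
  shows "b * (x k (t - \<tau> i k) \<bullet> v - m) - K * (x i t \<bullet> v - m) \<le> rate v i t"
proof -
  have ge': "m \<le> x j (t - \<tau> i j) \<bullet> v" if "j \<in> I" for j
    using ge[of j "t - \<tau> i j"] delay_le[of i j] that assms by simp
  have "m \<le> x i t \<bullet> v"
    using ge[of i t] assms r_pos by simp
  have "b * (x k (t - \<tau> i k) \<bullet> v - m) \<le> A i k t * (x k (t - \<tau> i k) \<bullet> v - m)"
    using ge'[of k] assms by (intro mult_right_mono) auto
  also have "\<dots> \<le> (\<Sum>j\<in>I - {i}. A i j t * (x j (t - \<tau> i j) \<bullet> v - m))"
    using assms finite_I A_nonneg ge'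
    by (intro member_le_sum[where f = "\<lambda>j. A i j t * (x j (t - \<tau> i j) \<bullet> v - m)"]) auto
  finally have 1: "b * (x k (t - \<tau> i k) \<bullet> v - m)
      \<le> (\<Sum>j\<in>I - {i}. A i j t * (x j (t - \<tau> i j) \<bullet> v - m))" .
  have 2: "(\<Sum>j\<in>I - {i}. A i j t) * (x i t \<bullet> v - m) \<le> K * (x i t \<bullet> v - m)"
    using A_sum_le[of i t] assms \<open>m \<le> x i t \<bullet> v\<close> by (intro mult_right_mono) auto
  have "rate v i t = (\<Sum>j\<in>I - {i}. A i j t * (x j (t - \<tau> i j) \<bullet> v - m))
      - (\<Sum>j\<in>I - {i}. A i j t) * (x i t \<bullet> v - m)"
    unfolding rate_def sum_distrib_right sum_subtractf[symmetric]
    by (intro sum.cong) (simp_all add: algebra_simps)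
  with 1 2 show ?thesis by linarith
qed

text \<open>The sum \<open>u\<close> of the two gaps satisfies u' >= c (M - m) - K u and is
  nonnegative from time \<open>T\<close> on. A lead time \<open>r\<close> is allowed for it to build
  up.\<close>

lemma gap_sum_ge:
  assumes lower: "\<And>j s. j \<in> I \<Longrightarrow> T - r \<le> s \<Longrightarrow> m \<le> x j s \<bullet> v"
    and upper: "\<And>j s. j \<in> I \<Longrightarrow> T - r \<le> s \<Longrightarrow> x j s \<bullet> v \<le> M"
    and "0 \<le> T" "T + r \<le> t" "i \<in> I" "j \<in> I"
  shows "c / K * (1 - exp (- K * r)) * (M - m) \<le> (x i t \<bullet> v - m) + (M - x j t \<bullet> v)"
proof -
  obtain k where k: "k \<in> I - {i, j}" "\<tau> i k = \<tau> j k"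
    and c_le: "\<And>t. 0 < t \<Longrightarrow> c \<le> A i k t" "\<And>t. 0 < t \<Longrightarrow> c \<le> A j k t"
    using influencer[of i j] assms by blast
  define u where "u t = (x i t \<bullet> v - m) + (M - x j t \<bullet> v)" for t
  \<comment> \<open>Starting exactly \<open>r\<close> before \<open>t\<close> makes the gained
    fraction independent of \<open>t\<close>.\<close>
  define t0 where "t0 = t - r"
  have "T \<le> t0" "t0 \<le> t" using assms r_pos by (auto simp: t0_def)
  have "exp (- K * (t - t0)) * u t0 + c * (M - m) / K * (1 - exp (- K * (t - t0))) \<le> u t"
  proof (rule linear_differential_inequality
      [where u' = "\<lambda>t. rate v i t - rate v j t"])
    show "continuous_on {t0..t} u"
      unfolding u_def using assms \<open>T \<le> t0\<close> r_pos
      by (intro continuous_intros continuous_on_inner_trajectory) auto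
  next
    fix s
    assume s: "t0 < s" "s < t"
    then have "0 < s" "T < s" using assms \<open>T \<le> t0\<close> by auto
    show "(u has_real_derivative rate v i s - rate v j s) (at s)"
      unfolding u_def
      using has_derivative_inner[of i s v] has_derivative_inner[of j s v] assms \<open>0 < s\<close>
      by (auto intro!: derivative_eq_intros)
    have "c * (x k (s - \<tau> i k) \<bullet> v - m) - K * (x i s \<bullet> v - m) \<le> rate v i s"
      using assms k c_le \<open>T < s\<close> \<open>0 < s\<close> by (intro rate_ge[of T]) auto
    \<comment> \<open>The upper gap of \<open>j\<close> is its lower gap in direction
      \<open>- v\<close> with bound \<open>- M\<close>.\<close>
    moreover have "c * (x k (s - \<tau> j k) \<bullet> (- v) - (- M)) - K * (x j s \<bullet> (- v) - (- M))
        \<le> rate (- v) j s"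
      using assms k c_le \<open>T < s\<close> \<open>0 < s\<close> by (intro rate_ge[of T]) auto
    \<comment> \<open>By \<open>\<tau> i k = \<tau> j k\<close> both estimates contain the same
      value y of the influencer, and c (y - m) + c (M - y) = c (M - m).\<close>
    ultimately show "c * (M - m) - K * u s \<le> rate v i s - rate v j s"
      using k by (simp add: u_def rate_minus algebra_simps)
  qed (use \<open>t0 \<le> t\<close> K_pos in auto)
  moreover have "0 \<le> u t0"
    using lower[of i t0] upper[of j t0] assms \<open>T \<le> t0\<close> r_pos by (simp add: u_def)
  then have "0 \<le> exp (- K * (t - t0)) * u t0" by simp
  ultimately have "c * (M - m) / K * (1 - exp (- K * (t - t0))) \<le> u t"
    by linarith
  moreover have "c * (M - m) / K * (1 - exp (- K * (t - t0)))
      = c / K * (1 - exp (- K * r)) * (M - m)"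
    by (simp add: t0_def)
  ultimately show ?thesis
    unfolding u_def by linarith
qed

lemma lower_gap_ge:
  assumes lower: "\<And>j s. j \<in> I \<Longrightarrow> T - r \<le> s \<Longrightarrow> m \<le> x j s \<bullet> v"
    and "0 \<le> T" "T \<le> s" "s \<le> t" "i \<in> I"
  shows "exp (- K * (t - s)) * (x i s \<bullet> v - m) \<le> x i t \<bullet> v - m"
proof -
  \<comment> \<open>Any agent other than \<open>i\<close> fits, since its term enters with
    \<open>b = 0\<close>; an influencer of the pair of \<open>i\<close> with itself is one.\<close>
  obtain k where k: "k \<in> I - {i}"
    using influencer[of i i] assms by blast
  have "exp (- K * (t - s)) * (x i s \<bullet> v - m) + 0 / K * (1 - exp (- K * (t - s)))
      \<le> x i t \<bullet> v - m"
  proof (rule linear_differential_inequality[where u' = "rate v i"])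
    show "continuous_on {s..t} (\<lambda>t. x i t \<bullet> v - m)"
      using assms r_pos by (intro continuous_intros continuous_on_inner_trajectory) auto
  next
    fix q
    assume "s < q" "q < t"
    then have "0 < q" "T < q" using assms by auto
    show "((\<lambda>t. x i t \<bullet> v - m) has_real_derivative rate v i q) (at q)"
      using has_derivative_inner[of i q v] assms \<open>0 < q\<close>
      by (auto intro!: derivative_eq_intros)
    show "0 - K * (x i q \<bullet> v - m) \<le> rate v i q"
      using rate_ge[OF lower \<open>0 \<le> T\<close> \<open>T < q\<close> \<open>i \<in> I\<close> k, of 0] A_nonneg[of i k q] k \<open>i \<in> I\<close> \<open>0 < q\<close>
      by simp
  qed (use \<open>s \<le> t\<close> K_pos in auto)
  then show ?thesis by simp
qed

text \<open>The gain from \<open>gap_sum_ge\<close>, multiplied by the loss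
  \<open>exp (- K * r)\<close> when a gap is carried over a time of at most
  \<open>r\<close>.\<close>

definition contraction_rate :: real where
  "contraction_rate = c / K * (1 - exp (- K * r)) * exp (- K * r)"

lemma contraction_rate_pos: "0 < contraction_rate"
  using K_pos c_pos r_pos by (simp add: contraction_rate_def)

text \<open>Both gaps are compared at the earlier time \<open>s\<close>, and only the upper gap of
  \<open>j\<close> is then carried on to \<open>t\<close>. The assumption \<open>s \<le> t\<close>
  decides which agent is carried.\<close>

lemma confined_step_ordered:
  assumes "confined T D" "0 \<le> T" "i \<in> I" "j \<in> I"
    and "T + r \<le> s" "s \<le> t" "t \<le> T + 2 * r"
  shows "norm (x j t - x i s) \<le> exp (- contraction_rate) * D"
proof -
  define v where "v = sgn (x j t - x i s)"
  have "norm v \<le> 1" by (simp add: v_def norm_sgn)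
  obtain m where lower: "\<And>i s. i \<in> I \<Longrightarrow> T - r \<le> s \<Longrightarrow> m \<le> x i s \<bullet> v"
    and upper: "\<And>i s. i \<in> I \<Longrightarrow> T - r \<le> s \<Longrightarrow> x i s \<bullet> v \<le> m + D"
    using assms(1,2) \<open>norm v \<le> 1\<close> by (rule confined_bounds) blast
  define e where "e = exp (- K * r)"
  have e: "0 < e" "e \<le> 1" using K_pos r_pos by (auto simp: e_def)
  have upper': "- (m + D) \<le> x i s \<bullet> (- v)" if "i \<in> I" "T - r \<le> s" for i s
    using upper[OF that] by simp
  define p q where "p = x i s \<bullet> v - m" and "q = m + D - x j s \<bullet> v"
  have "0 \<le> p" "0 \<le> q"
    using lower[of i s] upper[of j s] assms r_pos by (auto simp: p_def q_def)
  have sum: "c / K * (1 - e) * D \<le> p + q"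
    using gap_sum_ge[OF lower upper \<open>0 \<le> T\<close> \<open>T + r \<le> s\<close> \<open>i \<in> I\<close> \<open>j \<in> I\<close>]
    by (simp add: p_def q_def e_def)
  have "e * q \<le> exp (- K * (t - s)) * q"
    unfolding e_def using assms(5-7) K_pos \<open>0 \<le> q\<close> by (intro mult_right_mono) auto
  also have "\<dots> = exp (- K * (t - s)) * (x j s \<bullet> (- v) - - (m + D))"
    by (simp add: q_def)
  also have "\<dots> \<le> x j t \<bullet> (- v) - - (m + D)"
    using assms(2-6) r_pos by (intro lower_gap_ge[OF upper']) auto
  also have "\<dots> = m + D - x j t \<bullet> v"
    by simp
  finally have q: "e * q \<le> m + D - x j t \<bullet> v" .
  \<comment> \<open>The factor \<open>e\<close> is given away here so that both gaps carry the same
    factor and their sum can be used.\<close>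
  have p: "e * p \<le> p"
    using e \<open>0 \<le> p\<close> by (simp add: mult_left_le_one_le)
  have "contraction_rate * D = e * (c / K * (1 - e) * D)"
    by (simp add: contraction_rate_def e_def)
  also have "\<dots> \<le> e * (p + q)"
    using sum e by (intro mult_left_mono) auto
  also have "\<dots> \<le> D - (x j t - x i s) \<bullet> v"
    using p q by (simp add: p_def inner_diff_left algebra_simps)
  finally have "(x j t - x i s) \<bullet> v \<le> (1 - contraction_rate) * D"
    by (simp add: algebra_simps)
  also have "(x j t - x i s) \<bullet> v = norm (x j t - x i s)"
    by (simp add: v_def inner_sgn_eq_norm)
  also have "0 \<le> D"
    using lower[of i s] upper[of i s] assms r_pos by simp
  \<comment> \<open>The bound 1 - a <= exp (- a) turns the factor into an exponential, which
    iterates cleanly.\<close>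
  then have "(1 - contraction_rate) * D \<le> exp (- contraction_rate) * D"
    using exp_ge_add_one_self[of "- contraction_rate"] by (intro mult_right_mono) auto
  finally show ?thesis .
qed

text \<open>The window ending at \<open>T + 2 * r\<close> begins at \<open>T + r\<close>, where the
  gap estimate becomes available. Symmetry of the norm allows the two times to be ordered.\<close>

lemma confined_step:
  assumes "confined T D" "0 \<le> T"
  shows "confined (T + 2 * r) (exp (- contraction_rate) * D)"
  unfolding confined_def
proof (intro ballI)
  fix i j s t
  assume *: "i \<in> I" "j \<in> I" "s \<in> {T + 2 * r - r..T + 2 * r}" "t \<in> {T + 2 * r - r..T + 2 * r}"
  show "norm (x i s - x j t) \<le> exp (- contraction_rate) * D"
    using confined_step_ordered[OF assms, of i j s t] confined_step_ordered[OF assms, of j i t s] *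
    by (cases "s \<le> t") (auto simp: norm_minus_commute)
qed

lemma confined_iterate:
  assumes "confined 0 D"
  shows "confined (2 * r * real n) (exp (- contraction_rate * real n) * D)"
proof (induction n)
  case 0
  then show ?case using assms by simp
next
  case (Suc n)
  have "exp (- contraction_rate * real (Suc n))
      = exp (- contraction_rate) * exp (- contraction_rate * real n)"
    by (simp add: exp_add[symmetric] algebra_simps)
  moreover have "2 * r * real (Suc n) = 2 * r * real n + 2 * r"
    by (simp add: algebra_simps)
  ultimately show ?case
    using confined_step[OF Suc] r_pos by (simp add: mult.assoc)
qed

text \<open>Up to time \<open>t\<close> there are \<open>n\<close> whole periods of length
  \<open>2 * r\<close>, each contributing one contraction. Rounding down loses at most one period,
  which is the shift by \<open>2 * r\<close> in the exponent.\<close>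

lemma exponential_decay:
  assumes "confined 0 D" "0 \<le> D" "i \<in> I" "j \<in> I" "0 \<le> t"
  shows "norm (x i t - x j t) \<le> D * exp (- (contraction_rate / (2 * r)) * (t - 2 * r))"
proof -
  define n where "n = nat \<lfloor>t / (2 * r)\<rfloor>"
  have "0 \<le> t / (2 * r)" using assms r_pos by simp
  then have "real n \<le> t / (2 * r)" "t / (2 * r) - 1 \<le> real n"
    unfolding n_def by linarith+
  then have n: "2 * r * real n \<le> t" "(t - 2 * r) / (2 * r) \<le> real n"
    using r_pos by (auto simp: field_simps)
  have "norm (x i t - x j t) \<le> exp (- contraction_rate * real n) * D"
    using n assms r_pos by (intro confined_forever[OF confined_iterate[OF assms(1)]]) auto
  also have "\<dots> \<le> exp (- (contraction_rate / (2 * r)) * (t - 2 * r)) * D"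
  proof -
    have "contraction_rate * ((t - 2 * r) / (2 * r)) \<le> contraction_rate * real n"
      using n contraction_rate_pos by (intro mult_left_mono) auto
    then show ?thesis
      using \<open>0 \<le> D\<close> by (intro mult_right_mono) auto
  qed
  finally show ?thesis by (simp only: mult.commute)
qed

end

section \<open>Diameters as maxima and uniform bounds for influence functions\<close>

lemma finite_pair_values: "finite I \<Longrightarrow> finite {f i j |i j. i \<in> I \<and> j \<in> I}"
  using finite_image_set2[of "\<lambda>i. i \<in> I" "\<lambda>j. j \<in> I" f] by simp

lemma delay_le_max_delay:
  assumes "i \<in> {1..N}" "j \<in> {1..N}"
  shows "\<tau> i j \<le> max_delay N \<tau>"
  unfolding max_delay_def using assms by (intro Max_ge finite_pair_values) auto

text \<open>The supremum dominates its members only if they are bounded above; continuity on the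
  compact square of times provides this.\<close>

lemma norm_diff_le_initial_diameter:
  fixes x :: "nat \<Rightarrow> real \<Rightarrow> real^'d"
  assumes cont: "\<And>i. i \<in> {1..N} \<Longrightarrow> continuous_on {- max_delay N \<tau>..0} (x i)"
    and "i \<in> {1..N}" "j \<in> {1..N}" "s \<in> {- max_delay N \<tau>..0}" "t \<in> {- max_delay N \<tau>..0}"
  shows "norm (x i s - x j t) \<le> initial_diameter N \<tau> x"
proof -
  let ?S = "{- max_delay N \<tau>..0}"
  let ?g = "\<lambda>(s, t). norm (x i s - x j t)"
  have "continuous_on (?S \<times> ?S) ?g"
    unfolding case_prod_beta
    by (intro continuous_intros continuous_on_compose2[OF cont] assms) auto
  then have "compact (?g ` (?S \<times> ?S))"
    by (intro compact_continuous_image compact_Times) auto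
  then have "bdd_above (?g ` (?S \<times> ?S))"
    by (intro bounded_imp_bdd_above compact_imp_bounded)
  then have "?g (s, t) \<le> (SUP p \<in> ?S \<times> ?S. ?g p)"
    using assms by (intro cSUP_upper) auto
  also have "\<dots> \<le> initial_diameter N \<tau> x"
    unfolding initial_diameter_def using assms by (intro Max_ge finite_pair_values) auto
  finally show ?thesis by simp
qed

lemma opinion_diameter_le:
  assumes "1 \<le> N" and "\<And>i j. i \<in> {1..N} \<Longrightarrow> j \<in> {1..N} \<Longrightarrow> norm (x i t - x j t) \<le> b"
  shows "opinion_diameter N x t \<le> b"
proof -
  have "norm (x 1 t - x 1 t) \<in> {norm (x i t - x j t) |i j. i \<in> {1..N} \<and> j \<in> {1..N}}"
    using \<open>1 \<le> N\<close> by fastforce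
  then show ?thesis
    unfolding opinion_diameter_def using assms(2)
    by (subst Max_le_iff[OF finite_pair_values]) auto
qed

text \<open>Each function attains a positive minimum on a nonempty compact set, and the least of
  finitely many positive numbers is positive.\<close>

lemma uniform_positive_lower_bound:
  fixes f :: "'i \<Rightarrow> 'a::topological_space \<Rightarrow> real"
  assumes "finite I" "compact C"
    and "\<And>i. i \<in> I \<Longrightarrow> continuous_on C (f i)"
    and "\<And>i p. i \<in> I \<Longrightarrow> p \<in> C \<Longrightarrow> 0 < f i p"
  shows "\<exists>b>0. \<forall>i\<in>I. \<forall>p\<in>C. b \<le> f i p"
  using assms
proof (induction I rule: finite_induct)
  case empty
  then show ?case by (auto intro: exI[of _ 1])
next
  case (insert i I)
  then obtain b where b: "b > 0" "\<forall>i\<in>I. \<forall>p\<in>C. b \<le> f i p"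
    by auto
  obtain b' where b': "b' > 0" "\<forall>p\<in>C. b' \<le> f i p"
  proof (cases "C = {}")
    case True
    then show ?thesis using that[of 1] by simp
  next
    case False
    then obtain p where "p \<in> C" "\<forall>q\<in>C. f i p \<le> f i q"
      using continuous_attains_inf[of C "f i"] insert.prems by auto
    then show ?thesis using that[of "f i p"] insert.prems by simp
  qed
  show ?case
    using b b' by (intro exI[of _ "min b b'"]) (auto simp: min_le_iff_disj)
qed

lemma uniform_upper_bound:
  fixes f :: "'i \<Rightarrow> 'a \<Rightarrow> real"
  assumes "finite I" and "\<And>i. i \<in> I \<Longrightarrow> bounded (range (f i))"
  shows "\<exists>b>0. \<forall>i\<in>I. \<forall>p. f i p \<le> b"
proof -
  have "bounded (\<Union>i\<in>I. range (f i))"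
    using assms by (intro bounded_UN) auto
  then obtain b where "b > 0" "\<forall>y\<in>(\<Union>i\<in>I. range (f i)). norm y \<le> b"
    by (auto simp: bounded_pos)
  then show ?thesis
    by (intro exI[of _ b]) (auto simp: abs_le_iff)
qed

section \<open>Application of the abstract decay estimate to the opinion model\<close>

theorem theorem3p1:
  fixes N :: nat
    and chi \<tau> :: "nat \<Rightarrow> nat \<Rightarrow> real"
    and \<psi> :: "nat \<Rightarrow> nat \<Rightarrow> (real^'d) \<times> (real^'d) \<Rightarrow> real"
    and x0 x :: "nat \<Rightarrow> real \<Rightarrow> real^'d"
  assumes "N \<ge> 3"
    and "\<And>i j. i \<in> {1..N} \<Longrightarrow> j \<in> {1..N} \<Longrightarrow> \<tau> i j > 0"
    and "\<And>i j. i \<in> {1..N} \<Longrightarrow> j \<in> {1..N} \<Longrightarrow> chi i j \<in> {0, 1}"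
    and "\<And>i j p. i \<in> {1..N} \<Longrightarrow> j \<in> {1..N} \<Longrightarrow> \<psi> i j p > 0"
    and "\<And>i j. i \<in> {1..N} \<Longrightarrow> j \<in> {1..N} \<Longrightarrow> bounded (range (\<psi> i j))"
    and "\<And>i j. i \<in> {1..N} \<Longrightarrow> j \<in> {1..N} \<Longrightarrow> continuous_on UNIV (\<psi> i j)"
    and "\<And>i. i \<in> {1..N} \<Longrightarrow> continuous_on {- max_delay N \<tau>..0} (x0 i)"
    and "common_influencer N chi \<tau>"
    and "is_solution N chi \<tau> \<psi> x0 x"
  shows "\<exists>\<gamma>>0. \<forall>t\<ge>0.
    opinion_diameter N x t \<le> initial_diameter N \<tau> x * exp (- \<gamma> * (t - 2 * max_delay N \<tau>))"
proof -
  let ?I = "{1..N}"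
  define r where "r = max_delay N \<tau>"
  define D where "D = initial_diameter N \<tau> x"
  define A where "A i j t = chi i j * weight \<psi> \<tau> x i j t / (real N - 1)" for i j t
  have N: "real N - 1 > 0" using assms(1) by simp
  have A_nonneg: "0 \<le> A i j t" if "i \<in> ?I" "j \<in> ?I" for i j t
    using assms(3,4)[OF that] N by (force simp: A_def weight_def intro: less_imp_le)
  have r_pos: "0 < r"
    using assms(1) assms(2)[of 1 1] delay_le_max_delay[of 1 N 1 \<tau>] by (simp add: r_def)
  have continuous: "continuous_on {- r..} (x i)" if "i \<in> ?I" for i
    using assms(9) that by (simp add: is_solution_def r_def)
  \<comment> \<open>The interpretation has two stages. Nonnegative weights already confine the
    trajectories, and only this confinement yields the positive lower bound on the weights that the
    second locale demands.\<close>
  interpret delayed_averaging ?I \<tau> r A x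
  proof
    fix i and t :: real
    assume "i \<in> ?I" "0 < t"
    then have "(x i has_vector_derivative (1 / (real N - 1)) *\<^sub>R
        (\<Sum>j\<in>?I - {i}. (chi i j * weight \<psi> \<tau> x i j t) *\<^sub>R (x j (t - \<tau> i j) - x i t))) (at t)"
      using assms(9) by (simp add: is_solution_def)
    then show "(x i has_vector_derivative
        (\<Sum>j\<in>?I - {i}. A i j t *\<^sub>R (x j (t - \<tau> i j) - x i t))) (at t)"
      by (simp add: A_def scaleR_sum_right)
  qed (use assms(2) delay_le_max_delay continuous A_nonneg in \<open>auto simp: r_def\<close>)
  have D: "norm (x i s - x j t) \<le> D"
    if "i \<in> ?I" "j \<in> ?I" "s \<in> {- r..0}" "t \<in> {- r..0}" for i j s t
    unfolding D_def
    using that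
    by (intro norm_diff_le_initial_diameter continuous_on_subset[OF continuous]) (auto simp: r_def)
  have "confined 0 D"
    unfolding confined_def using D by simp
  have "0 \<le> D"
    using D[of 1 1 0 0] assms(1) r_pos by simp
  \<comment> \<open>Every opinion stays within distance \<open>D\<close> of \<open>x 1 0\<close>
    from time \<open>- r\<close> on, so all arguments of the influence functions lie in the compact
    set \<open>C \<times> C\<close>.\<close>
  define C where "C = cball (x 1 0) D"
  have C: "x i s \<in> C" if "i \<in> ?I" "- r \<le> s" for i s
    using confined_forever[OF \<open>confined 0 D\<close>, of 1 i 0 s] assms(1) r_pos that
    by (simp add: C_def dist_norm)
  have "\<exists>b>0. \<forall>ij\<in>?I \<times> ?I. \<forall>p\<in>C \<times> C. b \<le> \<psi> (fst ij) (snd ij) p"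
    using assms(4)
    by (intro uniform_positive_lower_bound compact_Times continuous_on_subset[OF assms(6)])
      (auto simp: C_def)
  then obtain b where b: "0 < b" "\<And>i j p. i \<in> ?I \<Longrightarrow> j \<in> ?I \<Longrightarrow> p \<in> C \<times> C \<Longrightarrow> b \<le> \<psi> i j p"
    by fastforce
  have "\<exists>K>0. \<forall>ij\<in>?I \<times> ?I. \<forall>p. \<psi> (fst ij) (snd ij) p \<le> K"
    using assms(5) by (intro uniform_upper_bound) auto
  then obtain K where K: "0 < K" "\<And>i j p. i \<in> ?I \<Longrightarrow> j \<in> ?I \<Longrightarrow> \<psi> i j p \<le> K"
    by fastforce
  \<comment> \<open>Each agent has \<open>N - 1\<close> such weights, so they add up to at most
    \<open>K\<close>. If \<open>chi i j = 0\<close>, the bound holds because \<open>K\<close> is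
    positive.\<close>
  have A_le: "A i j t \<le> K / (real N - 1)" if "i \<in> ?I" "j \<in> ?I" for i j t
    using assms(3)[OF that] K(2)[OF that] K(1) N
    by (auto simp: A_def weight_def intro!: divide_right_mono)
  \<comment> \<open>Since \<open>\<tau> i k \<le> r\<close>, the delayed time is at least
    \<open>- r\<close>, and the delayed opinion also lies in \<open>C\<close>.\<close>
  have A_ge: "b / (real N - 1) \<le> A i k t" if "i \<in> ?I" "k \<in> ?I" "chi i k = 1" "0 < t" for i k t
    unfolding A_def weight_def
    using that C b(2)[of i k] delay_le_max_delay[of i N k \<tau>] r_pos N
    by (auto simp: r_def intro!: divide_right_mono)
  interpret delayed_averaging_common_influencer ?I \<tau> r A x K "b / (real N - 1)"
  proof
    fix i and t :: real
    assume i: "i \<in> ?I"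
    have "(\<Sum>j\<in>?I - {i}. A i j t) \<le> (\<Sum>j\<in>?I - {i}. K / (real N - 1))"
      using A_le i by (intro sum_mono) auto
    also have "\<dots> = K"
      using i assms(1) N by (simp add: of_nat_diff)
    finally show "(\<Sum>j\<in>?I - {i}. A i j t) \<le> K" .
  next
    fix i j
    assume ij: "i \<in> ?I" "j \<in> ?I"
    then obtain k where "k \<in> ?I" "k \<noteq> i" "k \<noteq> j" "chi i k = 1" "chi j k = 1" "\<tau> i k = \<tau> j k"
      using assms(8) unfolding common_influencer_def by blast
    then show "\<exists>k\<in>?I - {i, j}. \<tau> i k = \<tau> j k \<and>
        (\<forall>t>0. b / (real N - 1) \<le> A i k t \<and> b / (real N - 1) \<le> A j k t)"
      using ij A_ge by (intro bexI[of _ k]) auto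
  qed (use K b N r_pos in auto)
  show ?thesis
  proof (intro exI conjI allI impI)
    \<comment> \<open>One factor \<open>exp (- contraction_rate)\<close> per time
      \<open>2 * r\<close> gives this decay rate. Through \<open>b\<close> and \<open>C\<close> it
      depends on the initial data.\<close>
    show "0 < contraction_rate / (2 * r)"
      using contraction_rate_pos r_pos by simp
  next
    fix t :: real
    assume "0 \<le> t"
    then show "opinion_diameter N x t \<le> initial_diameter N \<tau> x *
        exp (- (contraction_rate / (2 * r)) * (t - 2 * max_delay N \<tau>))"
      using exponential_decay[OF \<open>confined 0 D\<close> \<open>0 \<le> D\<close>] assms(1)
      unfolding D_def[symmetric] r_def[symmetric] by (intro opinion_diameter_le) auto
  qed
qed

end
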